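(* Let $A_1,A_2$ be the $4\times4$ matrices over $\mathbb{R}_{\max}$ whose only entries different from $\varepsilon=-\infty$ are the following. For both $s=1,2$: $(A_s)_{1,1}=(A_s)_{2,2}=(A_s)_{3,3}=0$ and $(A_s)_{3,4}=(A_s)_{4,1}=-100$; moreover $(A_1)_{1,2}=(A_1)_{2,3}=-100$ and $(A_2)_{1,2}=(A_2)_{2,3}=-1$. (Their common critical digraph consists of three strongly connected components, the loops at nodes $1$, $2$, $3$; both it and the common associated digraph have cyclicity $1$.) Then for every $t\ge2$ the product $(A_1)^t\otimes A_2$ is not CSR. Consequently, there are arbitrarily long products of matrices from $\{A_1,A_2\}$ that are not CSR.
   Context: $\mathbb{R}_{\max}=\mathbb{R}\cup\{-\infty\}$ with $a\oplus b=\max(a,b)$, $a\otimes b=a+b$; $(A\otimes B)_{i,j}=\max_l(a_{i,l}+b_{l,j})$; matrix powers are tropical and $A^0=I$ ($0$ on the diagonal, $\varepsilon$ elsewhere). The digraph associated with a square matrix $A$ has an edge $(i,j)$ of weight $a_{i,j}$ iff $a_{i,j}\ne\varepsilon$. The critical digraph of $A$ consists of all nodes and edges on cycles whose mean weight (weight/length) is maximal. The cyclicity of a strongly connected digraph is the gcd of its cycle lengths; that of a disjoint union of strongly connected components is the lcm of their cyclicities. CSR: let $\mathcal{E}_c$ be the edge set of the common critical digraph of the matrices in the set, $\gamma$ its cyclicity, $S$ the matrix with $S_{i,j}=0$ for $(i,j)\in\mathcal{E}_c$ and $\varepsilon$ otherwise, $T(S)$ the least $T$ with $S^{l+\gamma}=S^l$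 for all $l\ge T$, and $t_0$ any integer with $t_0\gamma\ge T(S)$. For a product $\Gamma(k)$ of $k$ matrices from the set, and $k\,(\mathrm{mod}\,\gamma)\in\{0,\dots,\gamma-1\}$, put $C=\Gamma(k)\otimes S^{(t_0+1)\gamma-k(\mathrm{mod}\,\gamma)}$ and $R=S^{(t_0+1)\gamma-k(\mathrm{mod}\,\gamma)}\otimes\Gamma(k)$. $\Gamma(k)$ is called CSR if $\Gamma(k)=C\otimes S^{k(\mathrm{mod}\,\gamma)}\otimes R$. *)

theory Defs
  imports
    "HOL-Analysis.Finite_Cartesian_Product"
    "HOL-Library.Numeral_Type"
    "Graph_Theory.Graph_Theory"
begin

section \<open>The max-plus semiring\<close>

datatype rmax = Eps (\<open>\<epsilon>\<close>) | Fin (real_val: real)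

text \<open>
  The class operations are the tropical ones: \<open>+\<close> is \<open>max\<close> and \<open>*\<close> is addition of reals, so \<open>0\<close> is
  \<open>\<epsilon>\<close> and \<open>1\<close> is \<open>Fin 0\<close>.  Consequently \<open>**\<close> is the max-plus matrix product and \<open>mat 1\<close> the max-plus
  identity.  Numerals at type \<open>rmax\<close> are all equal to \<open>1\<close>; real entries are written with \<open>Fin\<close>.
\<close>

instantiation rmax :: linorder
begin

fun less_eq_rmax :: "rmax \<Rightarrow> rmax \<Rightarrow> bool" where
  "\<epsilon> \<le> y \<longleftrightarrow> True"
| "Fin a \<le> \<epsilon> \<longleftrightarrow> False"
| "Fin a \<le> Fin b \<longleftrightarrow> a \<le> b"

definition less_rmax :: "rmax \<Rightarrow> rmax \<Rightarrow> bool" where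
  "x < y \<longleftrightarrow> x \<le> y \<and> \<not> y \<le> (x :: rmax)"

instance
proof
  fix x y z :: rmax
  show "x < y \<longleftrightarrow> x \<le> y \<and> \<not> y \<le> x" by (fact less_rmax_def)
  show "x \<le> x" by (cases x) auto
  show "x \<le> y \<Longrightarrow> y \<le> z \<Longrightarrow> x \<le> z" by (cases x; cases y; cases z) auto
  show "x \<le> y \<Longrightarrow> y \<le> x \<Longrightarrow> x = y" by (cases x; cases y) auto
  show "x \<le> y \<or> y \<le> x" by (cases x; cases y) auto
qed

end

instantiation rmax :: comm_semiring_1
begin

definition zero_rmax :: rmax where "0 = \<epsilon>"

definition one_rmax :: rmax where "1 = Fin 0"

definition plus_rmax :: "rmax \<Rightarrow> rmax \<Rightarrow> rmax" where "x + y = max x (y :: rmax)"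

fun times_rmax :: "rmax \<Rightarrow> rmax \<Rightarrow> rmax" where
  "Fin a * Fin b = Fin (a + b)"
| "\<epsilon> * y = \<epsilon>"
| "x * \<epsilon> = \<epsilon>"

instance
proof
  fix a b c :: rmax
  show "a + b + c = a + (b + c)" by (simp add: plus_rmax_def max.assoc)
  show "a + b = b + a" by (simp add: plus_rmax_def max.commute)
  show "0 + a = a" by (simp add: plus_rmax_def zero_rmax_def max_def)
  show "a * b * c = a * (b * c)" by (cases a; cases b; cases c) auto
  show "a * b = b * a" by (cases a; cases b) auto
  show "1 * a = a" by (cases a) (auto simp: one_rmax_def)
  show "(a + b) * c = a * c + b * c"
    by (cases a; cases b; cases c) (auto simp: plus_rmax_def max_def)
  show "0 * a = 0" by (cases a) (auto simp: zero_rmax_def)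
  show "a * 0 = 0" by (cases a) (auto simp: zero_rmax_def)
  show "(0::rmax) \<noteq> 1" by (simp add: zero_rmax_def one_rmax_def)
qed

end

text \<open>The operator \<open>^\<close> on the type of matrices is componentwise, hence a separate matrix power.\<close>

primrec mpow :: "'a::semiring_1^'n^'n \<Rightarrow> nat \<Rightarrow> 'a^'n^'n" where
  "mpow A 0 = mat 1"
| "mpow A (Suc k) = A ** mpow A k"

section \<open>Associated and critical digraphs, cyclicity\<close>

definition assoc_digraph :: "rmax^'n^'n \<Rightarrow> 'n pair_pre_digraph" where
  "assoc_digraph A = \<lparr> pverts = UNIV, parcs = {(i, j). A $ i $ j \<noteq> \<epsilon>} \<rparr>"

definition mean_weight :: "rmax^'n^'n \<Rightarrow> ('n \<times> 'n) list \<Rightarrow> real" where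
  "mean_weight A p = (\<Sum>(i, j)\<leftarrow>p. real_val (A $ i $ j)) / real (length p)"

definition critical_cycle :: "rmax^'n^'n \<Rightarrow> ('n \<times> 'n) list \<Rightarrow> bool" where
  "critical_cycle A p \<longleftrightarrow>
     pre_digraph.cycle (with_proj (assoc_digraph A)) p \<and>
     (\<forall>q. pre_digraph.cycle (with_proj (assoc_digraph A)) q \<longrightarrow> mean_weight A q \<le> mean_weight A p)"

definition critical_digraph :: "rmax^'n^'n \<Rightarrow> 'n pair_pre_digraph" where
  "critical_digraph A =
     \<lparr> pverts = {i. \<exists>p. critical_cycle A p \<and> i \<in> fst ` set p},
       parcs = {e. \<exists>p. critical_cycle A p \<and> e \<in> set p} \<rparr>"

text \<open>
  Cycle lengths are taken over elementary cycles; every closed walk splits into these, so the gcd is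
  that of all closed walks.  A component without any cycle would contribute \<open>Gcd {} = 0\<close>;
  critical digraphs have no such components.
\<close>

definition cyclicity :: "'n pair_pre_digraph \<Rightarrow> nat" where
  "cyclicity D =
     Lcm ((\<lambda>H. Gcd (length ` {p. pre_digraph.cycle H p})) ` pre_digraph.sccs (with_proj D))"

section \<open>Products of matrices from a set and the CSR property\<close>

definition is_product :: "('a::semiring_1^'n^'n) set \<Rightarrow> nat \<Rightarrow> 'a^'n^'n \<Rightarrow> bool" where
  "is_product X k G \<longleftrightarrow>
     (\<exists>Bs. length Bs = k \<and> set Bs \<subseteq> X \<and> G = foldr (**) Bs (mat 1))"

text \<open>Meaningful only if all matrices in the set have the same critical digraph.\<close>

definition common_critical_digraph :: "(rmax^'n^'n) set \<Rightarrow> 'n pair_pre_digraph" where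
  "common_critical_digraph X = (THE D. \<forall>A\<in>X. critical_digraph A = D)"

definition crit_cyc :: "(rmax^'n^'n) set \<Rightarrow> nat" where
  "crit_cyc X = cyclicity (common_critical_digraph X)"

definition S_mat :: "(rmax^'n^'n) set \<Rightarrow> rmax^'n^'n" where
  "S_mat X = (\<chi> i j. if (i, j) \<in> parcs (common_critical_digraph X) then Fin 0 else \<epsilon>)"

definition S_threshold :: "(rmax^'n^'n) set \<Rightarrow> nat" where
  "S_threshold X = (LEAST T. \<forall>l\<ge>T. mpow (S_mat X) (l + crit_cyc X) = mpow (S_mat X) l)"

definition C_mat :: "(rmax^'n^'n) set \<Rightarrow> nat \<Rightarrow> nat \<Rightarrow> rmax^'n^'n \<Rightarrow> rmax^'n^'n" where
  "C_mat X t\<^sub>0 k G = G ** mpow (S_mat X) ((t\<^sub>0 + 1) * crit_cyc X - k mod crit_cyc X)"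

definition R_mat :: "(rmax^'n^'n) set \<Rightarrow> nat \<Rightarrow> nat \<Rightarrow> rmax^'n^'n \<Rightarrow> rmax^'n^'n" where
  "R_mat X t\<^sub>0 k G = mpow (S_mat X) ((t\<^sub>0 + 1) * crit_cyc X - k mod crit_cyc X) ** G"

text \<open>
  \<open>G\<close> stands for a product of \<open>k\<close> matrices from \<open>X\<close>, and \<open>t\<^sub>0\<close> for a number with
  \<open>t\<^sub>0 * crit_cyc X \<ge> S_threshold X\<close>.
\<close>

definition is_CSR :: "(rmax^'n^'n) set \<Rightarrow> nat \<Rightarrow> nat \<Rightarrow> rmax^'n^'n \<Rightarrow> bool" where
  "is_CSR X t\<^sub>0 k G \<longleftrightarrow>
     G = C_mat X t\<^sub>0 k G ** mpow (S_mat X) (k mod crit_cyc X) ** R_mat X t\<^sub>0 k G"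

section \<open>The two matrices\<close>

text \<open>The indices \<open>1, 2, 3, 4\<close> of type \<open>4\<close> are pairwise distinct and exhaust the type (\<open>4 = 0\<close> there).\<close>

definition ex_mat :: "real \<Rightarrow> rmax^4^4" where
  "ex_mat w = (\<chi> i j.
     if (i, j) \<in> {(1, 1), (2, 2), (3, 3)} then Fin 0
     else if (i, j) \<in> {(3, 4), (4, 1)} then Fin (- 100)
     else if (i, j) \<in> {(1, 2), (2, 3)} then Fin w
     else \<epsilon>)"

definition A\<^sub>1 :: "rmax^4^4" where "A\<^sub>1 = ex_mat (- 100)"

definition A\<^sub>2 :: "rmax^4^4" where "A\<^sub>2 = ex_mat (- 1)"

end

theory Submission
  imports Defs "HOL-Analysis.Cartesian_Space"
begin

text \<open>
  All weights are nonpositive and the zero weights sit exactly on the loops at \<open>1\<close>, \<open>2\<close>, \<open>3\<close>, so the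
  critical cycles are these loops and \<open>S\<close> is idempotent.  Hence a product \<open>\<Gamma>\<close> is CSR iff
  \<open>\<Gamma> = \<Gamma> \<otimes> S \<otimes> \<Gamma>\<close>.  For \<open>\<Gamma> = A\<^sub>1\<^sup>t \<otimes> A\<^sub>2\<close> only the last step can use a cheap edge, so
  \<open>\<Gamma>\<^sub>1\<^sub>3 \<le> - 100\<close>, whereas \<open>\<Gamma>\<^sub>1\<^sub>2\<close> and \<open>\<Gamma>\<^sub>2\<^sub>3\<close> are at least \<open>- 1\<close> and \<open>S\<^sub>2\<^sub>2 = 0\<close>, so the right-hand side
  has \<open>(1, 3)\<close>-entry at least \<open>- 2\<close>.
\<close>

section \<open>Max-plus arithmetic\<close>

lemma rmax_mult_mono: "a * c \<le> b * d" if "a \<le> b" "c \<le> d" for a b c d :: rmax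
  using that by (cases a; cases b; cases c; cases d) auto

lemma rmax_sum_le_iff: "finite I \<Longrightarrow> sum f I \<le> c \<longleftrightarrow> (\<forall>i\<in>I. f i \<le> (c :: rmax))"
  by (induction I rule: finite_induct) (auto simp: zero_rmax_def plus_rmax_def)

lemma matrix_mult_le_iff:
  fixes A :: "rmax^'m^'n" and B :: "rmax^'k^'m"
  shows "(A ** B) $ i $ j \<le> c \<longleftrightarrow> (\<forall>l. A $ i $ l * B $ l $ j \<le> c)"
  by (simp add: matrix_matrix_mult_def rmax_sum_le_iff)

lemma matrix_mult_ge:
  fixes A :: "rmax^'m^'n" and B :: "rmax^'k^'m"
  assumes "a \<le> A $ i $ l" "b \<le> B $ l $ j"
  shows "a * b \<le> (A ** B) $ i $ j"
  using rmax_mult_mono[OF assms] matrix_mult_le_iff[of A B i j "(A ** B) $ i $ j"] order_trans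
  by blast

text \<open>The bounding pattern is closed under the max-plus product. A path from \<open>i\<close>
  to \<open>j\<close> with \<open>i \<noteq> j\<close> leaves the diagonal at least once, and every
  further off-diagonal step only lowers the weight because \<open>c \<le> 0\<close>.\<close>

lemma mpow_le:
  fixes A :: "rmax^'n^'n"
  assumes "c \<le> 0" "\<And>i j. A $ i $ j \<le> (if i = j then Fin 0 else Fin c)"
  shows "mpow A t $ i $ j \<le> (if i = j then Fin 0 else Fin c)"
proof (induction t arbitrary: i j)
  case 0
  show ?case by (simp add: mat_def one_rmax_def zero_rmax_def)
next
  case (Suc t)
  have "A $ i $ l * mpow A t $ l $ j \<le> (if i = j then Fin 0 else Fin c)" for l
  proof -
    have "A $ i $ l * mpow A t $ l $ j \<le>
        (if i = l then Fin 0 else Fin c) * (if l = j then Fin 0 else Fin c)"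
      by (intro rmax_mult_mono assms Suc)
    also have "\<dots> \<le> (if i = j then Fin 0 else Fin c)"
      using assms(1) by auto
    finally show ?thesis .
  qed
  then show ?case by (simp add: matrix_mult_le_iff)
qed

text \<open>Going \<open>t\<close> times around the loop at \<open>i\<close> is one of the paths
  over which the power maximises.\<close>

lemma mpow_diag_nonneg:
  fixes A :: "rmax^'n^'n"
  assumes "Fin 0 \<le> A $ i $ i"
  shows "Fin 0 \<le> mpow A t $ i $ i"
proof (induction t)
  case 0
  show ?case by (simp add: mat_def one_rmax_def)
next
  case (Suc t)
  show ?case using matrix_mult_ge[OF assms Suc] by simp
qed

lemma mpow_idempotent: "A ** A = A \<Longrightarrow> mpow A (Suc n) = A"
  by (induction n) auto

lemma foldr_replicate_mult_eq_mpow: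
  "foldr (**) (replicate t A @ [B]) (mat 1) = mpow A t ** B"
  by (induction t) (auto simp: matrix_mul_assoc)

section \<open>Strongly connected components and cyclicity\<close>

lemma cycle_loop:
  "(i, i) \<in> arcs H \<Longrightarrow> i \<in> verts H \<Longrightarrow> tail H = fst \<Longrightarrow> head H = snd \<Longrightarrow>
     pre_digraph.cycle H [(i, i)]"
  by (auto simp: pre_digraph.cycle_def pre_digraph.awalk_def pre_digraph.cas.simps
      pre_digraph.awalk_verts.simps)

text \<open>A loop is a cycle of length 1, so it forces the gcd of its component to be 1, and an lcm
  of ones is 1.\<close>

lemma cyclicity_eq_1_if_loops:
  assumes "\<And>H. H \<in> pre_digraph.sccs (with_proj D) \<Longrightarrow> \<exists>i. i \<in> verts H \<and> (i, i) \<in> parcs D"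
  shows "cyclicity D = 1"
proof -
  have "Gcd (length ` {p. pre_digraph.cycle H p}) = 1" if H: "H \<in> pre_digraph.sccs (with_proj D)" for H
  proof -
    have "induced_subgraph H (with_proj D)"
      using H by (rule pre_digraph.in_sccs_imp_induced)
    moreover obtain i where "i \<in> verts H" "(i, i) \<in> parcs D"
      using assms H by blast
    ultimately have "pre_digraph.cycle H [(i, i)]"
      by (intro cycle_loop) (auto simp: induced_subgraph_def subgraph_def compatible_def)
    then have "1 \<in> length ` {p. pre_digraph.cycle H p}"
      by force
    then show ?thesis
      by (metis Gcd_dvd nat_dvd_1_iff_1)
  qed
  then show ?thesis
    using Lcm_least[of "(\<lambda>H. Gcd (length ` {p. pre_digraph.cycle H p})) ` pre_digraph.sccs (with_proj D)" 1]
    unfolding cyclicity_def by auto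
qed

text \<open>Loops lead nowhere else, so reachability is equality on \<open>V\<close> and the maximal
  mutually reachable sets are singletons.\<close>

lemma sccs_loops:
  fixes V :: "'a set"
  shows "pre_digraph.sccs (with_proj \<lparr> pverts = V, parcs = Id_on V \<rparr>) =
     (\<lambda>i. with_proj \<lparr> pverts = {i}, parcs = {(i, i)} \<rparr>) ` V"
proof -
  let ?D = "with_proj \<lparr> pverts = V, parcs = Id_on V \<rparr>"
  interpret wf_digraph ?D by unfold_locales auto
  have reach: "u \<rightarrow>\<^sup>*\<^bsub>?D\<^esub> v \<longleftrightarrow> u = v \<and> u \<in> V" for u v
  proof
    assume "u \<rightarrow>\<^sup>*\<^bsub>?D\<^esub> v"
    then show "u = v \<and> u \<in> V"
      by (induction rule: reachable_induct) auto
  qed auto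
  have "sccs_verts = (\<lambda>i. {i}) ` V"
    unfolding sccs_verts_def reach by blast
  then show ?thesis
    unfolding sccs_conv_sccs_verts by (auto simp: image_image induce_subgraph_def with_proj_def intro!: image_cong)
qed

lemma cyclicity_loops: "cyclicity \<lparr> pverts = V, parcs = Id_on V \<rparr> = 1"
  by (rule cyclicity_eq_1_if_loops) (auto simp: sccs_loops)

text \<open>Components are maximal: a component on fewer vertices could be enlarged by any missing
  vertex, since all vertices are mutually reachable.\<close>

lemma verts_scc_if_strongly_connected:
  assumes "wf_digraph G" "strongly_connected G" "H \<in> pre_digraph.sccs G"
  shows "verts H = verts G"
proof -
  interpret wf_digraph G by fact
  have "verts H \<in> sccs_verts"
    using assms(3) sccs_verts_conv by blast
  moreover have "verts H \<subseteq> verts G"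
    using in_sccs_imp_induced[OF assms(3)] by (auto simp: induced_subgraph_def subgraph_def)
  ultimately show ?thesis
    using assms(2) unfolding sccs_verts_def strongly_connected_def by blast
qed

section \<open>Critical digraphs consisting of loops\<close>

text \<open>No cycle mean exceeds 0, and the loop at \<open>k\<close> attains 0. A critical cycle is
  therefore a sum of nonpositive weights equal to 0, so all its weights vanish and all its edges are
  loops.\<close>

lemma critical_digraph_zero_loops:
  fixes A :: "rmax^'n^'n"
  assumes nonpos: "\<And>i j. A $ i $ j \<le> Fin 0"
    and zero_diag: "\<And>i j. A $ i $ j = Fin 0 \<Longrightarrow> i = j"
    and zero: "A $ k $ k = Fin 0"
  defines "V \<equiv> {i. A $ i $ i = Fin 0}"
  shows "critical_digraph A = \<lparr> pverts = V, parcs = Id_on V \<rparr>"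
proof -
  let ?cycle = "pre_digraph.cycle (with_proj (assoc_digraph A))"
  have nonpos': "real_val (A $ i $ j) \<le> 0" if "A $ i $ j \<noteq> \<epsilon>" for i j
    using that nonpos[of i j] by (cases "A $ i $ j") auto
  have cycleD: "p \<noteq> []" "\<And>i j. (i, j) \<in> set p \<Longrightarrow> A $ i $ j \<noteq> \<epsilon>" if "?cycle p" for p
    using that by (auto simp: pre_digraph.cycle_def pre_digraph.awalk_def assoc_digraph_def)
  have mean_le: "mean_weight A p \<le> 0" if "?cycle p" for p
  proof -
    have "(\<Sum>(i, j)\<leftarrow>p. real_val (A $ i $ j)) \<le> 0"
      using cycleD(2)[OF that] by (intro sum_list_nonpos) (auto intro: nonpos')
    then show ?thesis
      by (simp add: mean_weight_def divide_nonpos_nonneg)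
  qed
  have loop: "critical_cycle A [(i, i)]" if "A $ i $ i = Fin 0" for i
    using that mean_le cycle_loop[of i "with_proj (assoc_digraph A)"]
    by (auto simp: critical_cycle_def assoc_digraph_def mean_weight_def)
  have zero_if_critical: "A $ i $ j = Fin 0" if "critical_cycle A p" "(i, j) \<in> set p" for p i j
  proof -
    have p: "?cycle p" and "mean_weight A [(k, k)] \<le> mean_weight A p"
      using that(1) loop[OF zero] by (auto simp: critical_cycle_def)
    then have "0 \<le> (\<Sum>(i, j)\<leftarrow>p. real_val (A $ i $ j))"
      using cycleD(1)[OF p] by (auto simp: mean_weight_def zero zero_le_divide_iff)
    \<comment> \<open>The signs are flipped to use that a sum of nonnegative terms vanishes only if
      each term does.\<close>
    then have "(\<Sum>(i, j)\<leftarrow>p. - real_val (A $ i $ j)) \<le> 0"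
      using uminus_sum_list_map[of "\<lambda>(i, j). real_val (A $ i $ j)" p]
      by (simp add: o_def case_prod_unfold)
    moreover have nonneg: "\<forall>x\<in>set (map (\<lambda>(i, j). - real_val (A $ i $ j)) p). 0 \<le> x"
      using cycleD(2)[OF p] nonpos' by auto
    ultimately have "\<forall>x\<in>set (map (\<lambda>(i, j). - real_val (A $ i $ j)) p). x = 0"
      using sum_list_nonneg_eq_0_iff sum_list_nonneg by (metis order_antisym)
    then have "real_val (A $ i $ j) = 0"
      using that(2) by force
    \<comment> \<open>\<open>real_val \<epsilon>\<close> is unspecified, so the entry must also be
      known to differ from \<epsilon>; it does, being the weight of an edge.\<close>
    then show ?thesis
      using cycleD(2)[OF p that(2)] by (cases "A $ i $ j") auto
  qed
  have "{e. \<exists>p. critical_cycle A p \<and> e \<in> set p} = Id_on V"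
  proof (intro set_eqI iffI)
    fix e assume "e \<in> {e. \<exists>p. critical_cycle A p \<and> e \<in> set p}"
    then obtain i j p where "e = (i, j)" "critical_cycle A p" "(i, j) \<in> set p"
      by (cases e) auto
    then show "e \<in> Id_on V"
      using zero_if_critical[of p i j] zero_diag[of i j] by (auto simp: V_def)
  next
    fix e assume "e \<in> Id_on V"
    then show "e \<in> {e. \<exists>p. critical_cycle A p \<and> e \<in> set p}"
      using loop by (force simp: V_def)
  qed
  moreover have "{i. \<exists>p. critical_cycle A p \<and> i \<in> fst ` set p} =
      fst ` {e. \<exists>p. critical_cycle A p \<and> e \<in> set p}"
    by blast
  ultimately show ?thesis
    by (force simp: critical_digraph_def)
qed

lemma common_critical_digraph_eqI:
  assumes "X \<noteq> {}" "\<And>A. A \<in> X \<Longrightarrow> critical_digraph A = D"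
  shows "common_critical_digraph X = D"
  unfolding common_critical_digraph_def using assms by (intro the_equality) auto

text \<open>Here \<gamma> = 1, so \<open>k mod 1 = 0\<close>: the middle power is the identity and
  both outer exponents are \<open>Suc t\<^sub>0\<close>. As \<open>S\<close> is idempotent, these
  positive powers collapse to \<open>S\<close>, and the two adjacent copies merge into one.\<close>

lemma is_CSR_loops:
  fixes X :: "(rmax^'n^'n) set"
  assumes "common_critical_digraph X = \<lparr> pverts = V, parcs = Id_on V \<rparr>"
  shows "is_CSR X t\<^sub>0 k G \<longleftrightarrow> G = G ** S_mat X ** G"
proof -
  have S: "S_mat X $ i $ j = (if i = j \<and> i \<in> V then 1 else 0)" for i j
    by (auto simp: S_mat_def assms one_rmax_def zero_rmax_def)
  have "(S_mat X ** S_mat X) $ i $ j = S_mat X $ i $ j" for i j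
  proof -
    \<comment> \<open>\<open>S\<close> is diagonal, so only the intermediate node
      \<open>l = i\<close> contributes.\<close>
    have "(S_mat X ** S_mat X) $ i $ j = (\<Sum>l\<in>UNIV. if l = i then S_mat X $ i $ j else 0)"
      unfolding matrix_matrix_mult_def vec_lambda_beta by (rule sum.cong) (auto simp: S)
    then show ?thesis by simp
  qed
  then have "S_mat X ** S_mat X = S_mat X"
    by (simp add: vec_eq_iff)
  moreover from this have "mpow (S_mat X) (Suc t\<^sub>0) = S_mat X"
    by (rule mpow_idempotent)
  moreover have "crit_cyc X = 1"
    by (simp add: crit_cyc_def assms cyclicity_loops)
  ultimately show ?thesis
    by (simp add: is_CSR_def C_mat_def R_mat_def matrix_mul_assoc del: mpow.simps(2))
       (metis matrix_mul_assoc)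
qed

section \<open>The example\<close>

lemma ex_mat_entries:
  "ex_mat w $ 1 $ 1 = Fin 0" "ex_mat w $ 1 $ 2 = Fin w" "ex_mat w $ 1 $ 3 = \<epsilon>" "ex_mat w $ 1 $ 4 = \<epsilon>"
  "ex_mat w $ 2 $ 1 = \<epsilon>" "ex_mat w $ 2 $ 2 = Fin 0" "ex_mat w $ 2 $ 3 = Fin w" "ex_mat w $ 2 $ 4 = \<epsilon>"
  "ex_mat w $ 3 $ 1 = \<epsilon>" "ex_mat w $ 3 $ 2 = \<epsilon>" "ex_mat w $ 3 $ 3 = Fin 0" "ex_mat w $ 3 $ 4 = Fin (- 100)"
  "ex_mat w $ 4 $ 1 = Fin (- 100)" "ex_mat w $ 4 $ 2 = \<epsilon>" "ex_mat w $ 4 $ 3 = \<epsilon>" "ex_mat w $ 4 $ 4 = \<epsilon>"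
  by (simp_all add: ex_mat_def)

text \<open>For \<open>w < 0\<close> every entry off the diagonal is negative or \<epsilon>, so the
  zero entries are exactly the three loops.\<close>

lemma critical_digraph_ex_mat:
  assumes "w < 0"
  shows "critical_digraph (ex_mat w) = \<lparr> pverts = {1, 2, 3}, parcs = Id_on {1, 2, 3} \<rparr>"
proof -
  have "\<forall>i j. ex_mat w $ i $ j \<le> Fin 0" "\<forall>i j. ex_mat w $ i $ j = Fin 0 \<longrightarrow> i = j"
    using assms by (simp_all add: forall_4 ex_mat_entries)
  moreover have "\<forall>i. ex_mat w $ i $ i = Fin 0 \<longleftrightarrow> i \<in> {1, 2, 3}"
    by (simp add: forall_4 ex_mat_entries)
  then have "{i. ex_mat w $ i $ i = Fin 0} = {1, 2, 3}"
    by blast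
  ultimately show ?thesis
    using critical_digraph_zero_loops[of "ex_mat w" 1] by (simp add: ex_mat_entries)
qed

lemma assoc_digraph_ex_mat:
  "assoc_digraph (ex_mat w) =
     \<lparr> pverts = UNIV, parcs = {(1, 1), (2, 2), (3, 3), (1, 2), (2, 3), (3, 4), (4, 1)} \<rparr>"
proof -
  have "\<forall>i j. ex_mat w $ i $ j \<noteq> \<epsilon> \<longleftrightarrow>
      (i, j) \<in> {(1, 1), (2, 2), (3, 3), (1, 2), (2, 3), (3, 4), (4, 1)}"
    by (simp add: forall_4 ex_mat_entries)
  then show ?thesis
    unfolding assoc_digraph_def by auto
qed

lemma cyclicity_assoc_digraph_ex_mat: "cyclicity (assoc_digraph (ex_mat w)) = 1"
proof (rule cyclicity_eq_1_if_loops)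
  fix H assume H: "H \<in> pre_digraph.sccs (with_proj (assoc_digraph (ex_mat w)))"
  let ?D = "with_proj (assoc_digraph (ex_mat w))"
  interpret wf_digraph ?D
    by unfold_locales (auto simp: assoc_digraph_ex_mat)
  \<comment> \<open>These four edges form a cycle through all nodes, so there is a single component,
    and it contains the loop at 1.\<close>
  have edges: "1 \<rightarrow>\<^sup>*\<^bsub>?D\<^esub> 2" "2 \<rightarrow>\<^sup>*\<^bsub>?D\<^esub> 3" "3 \<rightarrow>\<^sup>*\<^bsub>?D\<^esub> 4" "4 \<rightarrow>\<^sup>*\<^bsub>?D\<^esub> 1"
    by (rule reachable_adjI; simp add: assoc_digraph_ex_mat)+
  have "\<forall>v. 1 \<rightarrow>\<^sup>*\<^bsub>?D\<^esub> v \<and> v \<rightarrow>\<^sup>*\<^bsub>?D\<^esub> 1"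
    unfolding forall_4 using edges reachable_trans by metis
  then have "strongly_connected ?D"
    by (intro strongly_connectedI) (simp add: assoc_digraph_ex_mat, blast intro: reachable_trans)
  then have "verts H = UNIV"
    using verts_scc_if_strongly_connected[OF _ _ H] wf_digraph_axioms
    by (simp add: assoc_digraph_ex_mat)
  then show "\<exists>i. i \<in> verts H \<and> (i, i) \<in> parcs (assoc_digraph (ex_mat w))"
    by (auto simp: assoc_digraph_ex_mat)
qed

lemma common_critical_digraph_example:
  "common_critical_digraph {A\<^sub>1, A\<^sub>2} = \<lparr> pverts = {1, 2, 3}, parcs = Id_on {1, 2, 3} \<rparr>"
  by (rule common_critical_digraph_eqI) (auto simp: A\<^sub>1_def A\<^sub>2_def critical_digraph_ex_mat)

lemma not_CSR_example: "\<not> is_CSR {A\<^sub>1, A\<^sub>2} t\<^sub>0 k (mpow A\<^sub>1 t ** A\<^sub>2)"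
proof
  let ?S = "S_mat {A\<^sub>1, A\<^sub>2}" and ?G = "mpow A\<^sub>1 t ** A\<^sub>2"
  assume "is_CSR {A\<^sub>1, A\<^sub>2} t\<^sub>0 k ?G"
  then have CSR: "?G = ?G ** ?S ** ?G"
    using is_CSR_loops[OF common_critical_digraph_example] by blast
  have "\<forall>i j. A\<^sub>1 $ i $ j \<le> (if i = j then Fin 0 else Fin (- 100))"
    by (simp add: A\<^sub>1_def forall_4 ex_mat_entries)
  then have pow_le: "mpow A\<^sub>1 t $ i $ j \<le> (if i = j then Fin 0 else Fin (- 100))" for i j
    by (intro mpow_le) auto
  \<comment> \<open>Column 3 of \<open>A\<^sub>2\<close> is \<epsilon> in rows 1 and 4. The
    remaining terms are at most -100 - 1 for \<open>l = 2\<close> and -100 + 0 for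
    \<open>l = 3\<close>.\<close>
  have "\<forall>l. mpow A\<^sub>1 t $ 1 $ l * A\<^sub>2 $ l $ 3 \<le> Fin (- 100)"
    using rmax_mult_mono[OF pow_le[of 1 2] order_refl[of "Fin (- 1)"]] pow_le[of 1 3]
    by (cases "mpow A\<^sub>1 t $ 1 $ 1"; cases "mpow A\<^sub>1 t $ 1 $ 2"; cases "mpow A\<^sub>1 t $ 1 $ 3";
        cases "mpow A\<^sub>1 t $ 1 $ 4") (auto simp: forall_4 A\<^sub>2_def ex_mat_entries)
  then have "?G $ 1 $ 3 \<le> Fin (- 100)"
    by (simp add: matrix_mult_le_iff)
  moreover have "Fin 0 \<le> mpow A\<^sub>1 t $ i $ i" if "i \<in> {1, 2}" for i
    using that by (intro mpow_diag_nonneg) (auto simp: A\<^sub>1_def ex_mat_entries)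
  \<comment> \<open>Wait at the loop of node \<open>i\<close> during all factors
    \<open>A\<^sub>1\<close>, then take the cheap edge of \<open>A\<^sub>2\<close>.\<close>
  then have "Fin 0 * Fin (- 1) \<le> ?G $ i $ j" if "(i, j) \<in> {(1, 2), (2, 3)}" for i j
    using that by (intro matrix_mult_ge[where l = i]) (auto simp: A\<^sub>2_def ex_mat_entries)
  \<comment> \<open>The path goes from 1 to 2 in the first copy of \<open>?G\<close>, stays at 2 in
    \<open>?S\<close>, and goes from 2 to 3 in the second copy. Its weight -2 contradicts the upper
    bound -100.\<close>
  then have "Fin 0 * Fin (- 1) * Fin 0 * (Fin 0 * Fin (- 1)) \<le> (?G ** ?S ** ?G) $ 1 $ 3"
    by (intro matrix_mult_ge[where A = "?G ** ?S" and l = 2] matrix_mult_ge[where B = ?S and l = 2])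
       (auto simp: S_mat_def common_critical_digraph_example simp del: times_rmax.simps)
  ultimately show False
    unfolding CSR[symmetric] by (cases "?G $ 1 $ 3") auto
qed

theorem mainTheorem6:
  shows
    "critical_digraph A\<^sub>1 = \<lparr> pverts = {1, 2, 3}, parcs = {(1, 1), (2, 2), (3, 3)} \<rparr> \<and>
     critical_digraph A\<^sub>2 = critical_digraph A\<^sub>1 \<and>
     pre_digraph.sccs (with_proj (critical_digraph A\<^sub>1)) =
       (\<lambda>i. with_proj \<lparr> pverts = {i}, parcs = {(i, i)} \<rparr>) ` {1, 2, 3} \<and>
     cyclicity (critical_digraph A\<^sub>1) = 1 \<and>
     assoc_digraph A\<^sub>1 = assoc_digraph A\<^sub>2 \<and>
     cyclicity (assoc_digraph A\<^sub>1) = 1 \<and>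
     (\<forall>t\<^sub>0. t\<^sub>0 * crit_cyc {A\<^sub>1, A\<^sub>2} \<ge> S_threshold {A\<^sub>1, A\<^sub>2} \<longrightarrow>
        (\<forall>t\<ge>2. \<not> is_CSR {A\<^sub>1, A\<^sub>2} t\<^sub>0 (t + 1) (mpow A\<^sub>1 t ** A\<^sub>2)) \<and>
        (\<forall>N. \<exists>k\<ge>N. \<exists>G. is_product {A\<^sub>1, A\<^sub>2} k G \<and> \<not> is_CSR {A\<^sub>1, A\<^sub>2} t\<^sub>0 k G))"
proof -
  have crit: "critical_digraph A = \<lparr> pverts = {1, 2, 3}, parcs = Id_on {1, 2, 3} \<rparr>"
    if "A \<in> {A\<^sub>1, A\<^sub>2}" for A
    using that by (auto simp: A\<^sub>1_def A\<^sub>2_def critical_digraph_ex_mat)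
  have "Id_on {1, 2, 3 :: 4} = {(1, 1), (2, 2), (3, 3)}"
    by auto
  \<comment> \<open>With \<open>N\<close> factors \<open>A\<^sub>1\<close> and one final
    \<open>A\<^sub>2\<close> the length is \<open>Suc N\<close>, which exceeds any prescribed bound
    \<open>N\<close>.\<close>
  moreover have "is_product {A\<^sub>1, A\<^sub>2} (Suc N) (mpow A\<^sub>1 N ** A\<^sub>2)" for N
    unfolding is_product_def foldr_replicate_mult_eq_mpow[symmetric]
    by (intro exI[of _ "replicate N A\<^sub>1 @ [A\<^sub>2]"]) auto
  then have "\<exists>k\<ge>N. \<exists>G. is_product {A\<^sub>1, A\<^sub>2} k G \<and> \<not> is_CSR {A\<^sub>1, A\<^sub>2} t\<^sub>0 k G" for N t\<^sub>0
    using not_CSR_example le_Suc_eq by blast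
  moreover have "assoc_digraph A\<^sub>1 = assoc_digraph A\<^sub>2" "cyclicity (assoc_digraph A\<^sub>1) = 1"
    using cyclicity_assoc_digraph_ex_mat[of "- 100"]
    by (simp_all add: A\<^sub>1_def A\<^sub>2_def assoc_digraph_ex_mat)
  ultimately show ?thesis
    using crit cyclicity_loops[of "{1, 2, 3 :: 4}"] sccs_loops[of "{1, 2, 3 :: 4}"] not_CSR_example
    by simp
qed

end
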